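(* Let $k\in\mathbb{N}$ and let $\{a_i\}_{i=1}^k$ and $\{b_i\}_{i=1}^k$ be two non-decreasing sequences of positive real numbers. Let $p(x)=\prod_{i=1}^{k}(x+a_i)$ and $q(x)=\prod_{i=1}^{k}(x+b_i)$. Let $S_k$ denote the set of all permutations of $\{1,\dots,k\}$. Then: (1) If the sequence $\left\{\frac{p(n)}{q(n)}\right\}_{n\in\mathbb{Z}_+}$ is completely monotone, then there exists $\sigma\in S_k$ with $\sigma(1)=1$ such that $$\sum_{i=1}^{l}b_{\sigma(i)}\leq\sum_{i=1}^{l}a_{\sigma(i)}\qquad\text{for every } l\in\{1,\dots,k\}.$$ (2) If the sequence $\left\{\frac{p(n)}{q(n)}\right\}_{n\in\mathbb{Z}_+}$ is completely alternating, then there exists $\sigma\in S_k$ with $\sigma(1)=1$ such that $$\sum_{i=1}^{l}a_{\sigma(i)}\leq\sum_{i=1}^{l}b_{\sigma(i)}\qquad\text{for every } l\in\{1,\dots,k\}.$$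
   Context: $\mathbb{N}=\{1,2,3,\dots\}$ and $\mathbb{Z}_+=\{0,1,2,\dots\}$. For $a\in\mathbb{Z}_+$ and $g:\mathbb{Z}_+\to\mathbb{R}$, $(\nabla_a g)(m)=g(m)-g(m+a)$. A sequence $\phi:\mathbb{Z}_+\to\mathbb{R}$ is completely monotone if $\phi\geq 0$ and $\nabla_{a_1}\cdots\nabla_{a_n}\phi(m)\geq 0$ for all $n\geq 1$, all $a_1,\dots,a_n\in\mathbb{Z}_+$ (repetitions allowed) and all $m\in\mathbb{Z}_+$. A sequence $\psi:\mathbb{Z}_+\to\mathbb{R}$ is completely alternating if $\nabla_{a_1}\cdots\nabla_{a_n}\psi(m)\leq 0$ for all $n\geq 1$, all $a_1,\dots,a_n\in\mathbb{Z}_+$ (repetitions allowed) and all $m\in\mathbb{Z}_+$. *)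

theory Defs
  imports Complex_Main "HOL-Combinatorics.Permutations"
begin

definition nabla :: "nat \<Rightarrow> (nat \<Rightarrow> real) \<Rightarrow> nat \<Rightarrow> real" where
  "nabla a g m = g m - g (m + a)"

(* foldr nabla [a1, ..., an] g = nabla a1 (... (nabla an g)) *)

definition completely_monotone :: "(nat \<Rightarrow> real) \<Rightarrow> bool" where
  "completely_monotone \<phi> \<longleftrightarrow>
     (\<forall>m. 0 \<le> \<phi> m) \<and> (\<forall>as m. as \<noteq> [] \<longrightarrow> 0 \<le> foldr nabla as \<phi> m)"

definition completely_alternating :: "(nat \<Rightarrow> real) \<Rightarrow> bool" where
  "completely_alternating \<psi> \<longleftrightarrow>
     (\<forall>as m. as \<noteq> [] \<longrightarrow> foldr nabla as \<psi> m \<le> 0)"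

end

theory Submission
  imports Defs "HOL-Real_Asymp.Real_Asymp"
begin

text \<open>
  Put \<open>f n = p n / q n\<close>. Since \<open>f\<close> is monotone with limit \<open>1\<close>
  and \<open>n * (f n - 1)\<close> tends to \<open>\<Sum> (a i - b i)\<close>, that sum has the
  right sign. Next, the Newton series of \<open>f\<close> at the nodes \<open>0, 1, 2,
  \<dots>\<close> converges to \<open>p x / q x\<close> for all \<open>- b 1 < x < 0\<close>: the
  Newton remainders of \<open>h\<close> and of \<open>(n + c) * h n\<close> are linked by a
  first-order recurrence that is contracting for \<open>- c < x < 0\<close>, so convergence survives
  division by \<open>n + c\<close>. At \<open>x = - y < 0\<close> its terms are nonnegative
  multiples of \<open>(nabla 1 ^^ j) f 0\<close>, so \<open>f 0\<close> bounds its value from below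
  (completely monotone case) or from above (completely alternating case). The first excludes
  \<open>a 1 < b 1\<close> (take \<open>x = - a 1\<close>), the second excludes \<open>b 1 < a
  1\<close> (let \<open>x\<close> tend to \<open>- b 1\<close>). So \<open>a 1 - b 1\<close> and the
  total of the \<open>a i - b i\<close> have the right sign, and moving the differences of the wrong
  sign to the end gives the permutation.
\<close>

section \<open>Rearrangements with nonnegative partial sums\<close>

text \<open>Taking out a negative entry leaves the others with a sum above the nonnegative total, so
  induction orders them and the negative entry goes last. It never sits at index 1, because
  \<open>0 \<le> d 1\<close>.\<close>

lemma exists_permutation_nonneg_partial_sums:
  fixes d :: "nat \<Rightarrow> real"
  assumes "1 \<le> k" "0 \<le> d 1" "0 \<le> (\<Sum>i=1..k. d i)"
  shows "\<exists>\<sigma>. \<sigma> permutes {1..k} \<and> \<sigma> 1 = 1 \<and> (\<forall>l\<in>{1..k}. 0 \<le> (\<Sum>i=1..l. d (\<sigma> i)))"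
  using assms
proof (induction k arbitrary: d rule: nat_induct_at_least)
  case base
  then show ?case by (intro exI[of _ id]) auto
next
  case (Suc k)
  show ?case
  proof (cases "\<forall>i\<in>{1..Suc k}. 0 \<le> d i")
    case True
    then show ?thesis
      by (intro exI[of _ id] conjI permutes_id) (auto intro!: sum_nonneg)
  next
    case False
    then obtain j where j: "j \<in> {1..Suc k}" "d j < 0" by force
    with Suc.prems have j1: "j \<noteq> 1" by auto
    define \<tau> where "\<tau> = transpose j (Suc k)"
    have \<tau>: "\<tau> permutes {1..Suc k}"
      unfolding \<tau>_def using j by (intro permutes_swap_id) auto
    have \<tau>1: "\<tau> 1 = 1" using j1 Suc.hyps by (simp add: \<tau>_def transpose_def)
    have "(\<Sum>i=1..Suc k. d i) = (\<Sum>i=1..Suc k. d (\<tau> i))"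
      using sum.permute[OF \<tau>, of d] by (simp add: o_def)
    also have "\<dots> = (\<Sum>i=1..k. d (\<tau> i)) + d j"
      by (simp add: \<tau>_def)
    finally have "0 \<le> (\<Sum>i=1..k. d (\<tau> i))" using Suc.prems(2) j by linarith
    with Suc.IH[of "d \<circ> \<tau>"] Suc.prems \<tau>1 obtain \<rho> where
      \<rho>: "\<rho> permutes {1..k}" "\<rho> 1 = 1" "\<forall>l\<in>{1..k}. 0 \<le> (\<Sum>i=1..l. d (\<tau> (\<rho> i)))"
      by auto
    have \<rho>': "\<rho> permutes {1..Suc k}" using \<rho>(1) by (rule permutes_subset) auto
    have perm: "\<tau> \<circ> \<rho> permutes {1..Suc k}" by (rule permutes_compose[OF \<rho>' \<tau>])
    have "(\<Sum>i=1..Suc k. d (\<tau> (\<rho> i))) = (\<Sum>i=1..Suc k. d i)"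
      using sum.permute[OF perm, of d] by (simp add: o_def)
    with Suc.prems(2) have last: "0 \<le> (\<Sum>i=1..Suc k. d (\<tau> (\<rho> i)))" by simp
    have "0 \<le> (\<Sum>i=1..l. d ((\<tau> \<circ> \<rho>) i))" if "l \<in> {1..Suc k}" for l
    proof (cases "l = Suc k")
      case True
      then show ?thesis using last by simp
    next
      case False
      with that have "l \<in> {1..k}" by auto
      then show ?thesis using \<rho>(3) by simp
    qed
    moreover have "(\<tau> \<circ> \<rho>) 1 = 1" using \<tau>1 \<rho>(2) by simp
    ultimately show ?thesis using perm by blast
  qed
qed

section \<open>Algebra of iterated differences\<close>

lemma funpow_nabla_add:
  "(nabla 1 ^^ j) (\<lambda>n. f n + g n) m = (nabla 1 ^^ j) f m + (nabla 1 ^^ j) g m"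
  by (induction j arbitrary: m) (auto simp: nabla_def)

lemma funpow_nabla_cmult:
  "(nabla 1 ^^ j) (\<lambda>n. r * f n) m = r * (nabla 1 ^^ j) f m"
  by (induction j arbitrary: m) (auto simp: nabla_def algebra_simps)

lemma funpow_nabla_const: "(nabla 1 ^^ Suc j) (\<lambda>n. r) m = 0"
  by (induction j arbitrary: m) (auto simp: nabla_def)

text \<open>A discrete Leibniz rule: second and higher differences of a linear factor vanish, so
  only two terms survive. The order is \<open>Suc j\<close> to avoid a truncated
  \<open>j - 1\<close>.\<close>

lemma funpow_nabla_linear_mult:
  "(nabla 1 ^^ Suc j) (\<lambda>n. (real n + c) * f n) m =
     (real m + real j + 1 + c) * (nabla 1 ^^ Suc j) f m - real (Suc j) * (nabla 1 ^^ j) f m"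
proof (induction j arbitrary: m)
  case 0
  show ?case by (simp add: nabla_def algebra_simps)
next
  case (Suc j)
  define F where "F j m = (nabla 1 ^^ j) f m" for j m
  have F: "F (Suc j) m = F j m - F j (Suc m)" for j m
    by (simp add: F_def nabla_def)
  have "(nabla 1 ^^ Suc (Suc j)) (\<lambda>n. (real n + c) * f n) m =
      (real m + real j + 1 + c) * F (Suc j) m - real (Suc j) * F j m
      - ((real (Suc m) + real j + 1 + c) * F (Suc j) (Suc m) - real (Suc j) * F j (Suc m))"
    by (subst funpow.simps(2), subst o_apply, subst nabla_def, subst (1 2) Suc) (simp add: F_def)
  then show ?case
    unfolding F_def[symmetric] F by (simp add: algebra_simps)
qed

section \<open>A contracting first-order recurrence\<close>

text \<open>The products of the factors \<open>(N + y) / (N + c)\<close> decay like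
  \<open>N powr (y - c)\<close>, and a forcing term that is small relative to \<open>c - y\<close>
  adds only a small error.\<close>

lemma tendsto_zero_of_contracting_recurrence:
  fixes r e :: "nat \<Rightarrow> real"
  assumes y: "0 < y" "y < c" and e: "e \<longlonglongrightarrow> 0"
    and rec: "\<And>N. (real N + c) * r (Suc N) = (real N + y) * r N + e N"
  shows "r \<longlonglongrightarrow> 0"
proof (rule LIMSEQ_I)
  fix \<epsilon>' :: real assume "0 < \<epsilon>'"
  define \<epsilon> where "\<epsilon> = \<epsilon>' / 2"
  define \<delta> where "\<delta> = c - y"
  have \<epsilon>: "0 < \<epsilon>" and \<delta>: "0 < \<delta>" using \<open>0 < \<epsilon>'\<close> y by (auto simp: \<epsilon>_def \<delta>_def)
  obtain M where M: "\<And>N. N \<ge> M \<Longrightarrow> \<bar>e N\<bar> < \<epsilon> * \<delta>"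
    using LIMSEQ_D[OF e, of "\<epsilon> * \<delta>"] \<epsilon> \<delta> by auto
  \<comment> \<open>The constant \<open>\<epsilon>\<close> solves the recurrence with forcing
    \<open>\<epsilon> * \<delta>\<close>, so the excess of \<open>\<bar>r N\<bar>\<close> over it
    satisfies a homogeneous inequality. Clipping at 0 keeps \<open>u\<close> nonnegative, so the
    contraction factor may be replaced by a larger one.\<close>
  define u where "u N = max 0 (\<bar>r N\<bar> - \<epsilon>)" for N
  have u0: "0 \<le> u N" for N by (simp add: u_def)
  have step: "(real N + c) * u (Suc N) \<le> (real N + y) * u N" if "N \<ge> M" for N
  proof -
    have "(real N + c) * \<bar>r (Suc N)\<bar> = \<bar>(real N + c) * r (Suc N)\<bar>"
      using y by (simp add: abs_mult)
    also have "\<dots> \<le> \<bar>(real N + y) * r N\<bar> + \<bar>e N\<bar>"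
      unfolding rec by (rule abs_triangle_ineq)
    also have "\<bar>(real N + y) * r N\<bar> = (real N + y) * \<bar>r N\<bar>"
      using y by (simp add: abs_mult)
    finally have "(real N + c) * \<bar>r (Suc N)\<bar> \<le> (real N + y) * \<bar>r N\<bar> + \<epsilon> * \<delta>"
      using M[OF that] by linarith
    then have "(real N + c) * (\<bar>r (Suc N)\<bar> - \<epsilon>) \<le> (real N + y) * (\<bar>r N\<bar> - \<epsilon>)"
      by (simp add: \<delta>_def algebra_simps)
    also have "\<dots> \<le> (real N + y) * u N"
      using y by (intro mult_left_mono) (auto simp: u_def)
    finally have "(real N + c) * (\<bar>r (Suc N)\<bar> - \<epsilon>) \<le> (real N + y) * u N" .
    moreover have "0 \<le> (real N + y) * u N" using y u0 by simp
    ultimately show ?thesis unfolding u_def[of "Suc N"] by (auto simp: max_def)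
  qed
  \<comment> \<open>the contraction factor is at most \<open>((N + c) / (N + 1 + c)) powr \<delta>\<close>\<close>
  have dec: "u (Suc N) * (real (Suc N) + c) powr \<delta> \<le> u N * (real N + c) powr \<delta>"
    if "N \<ge> M" for N
  proof -
    have pos: "0 < real N + c" using y by linarith
    have "ln ((real (Suc N) + c) / (real N + c)) \<le> (real (Suc N) + c) / (real N + c) - 1"
      using pos by (intro ln_le_minus_one) simp
    also have "\<dots> = 1 / (real N + c)" using pos by (simp add: field_simps)
    finally have "\<delta> * ln ((real (Suc N) + c) / (real N + c)) \<le> \<delta> / (real N + c)"
      using \<delta> by (metis mult_left_mono less_imp_le times_divide_eq_right mult.right_neutral)
    moreover have "1 + - (\<delta> / (real N + c)) \<le> exp (- (\<delta> / (real N + c)))"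
      by (rule exp_ge_add_one_self)
    ultimately have "1 - \<delta> / (real N + c) \<le> exp (- (\<delta> * ln ((real (Suc N) + c) / (real N + c))))"
      by (smt (verit) exp_le_cancel_iff)
    also have "\<dots> = ((real N + c) / (real (Suc N) + c)) powr \<delta>"
      using pos by (simp add: powr_def ln_div algebra_simps)
    finally have "1 - \<delta> / (real N + c) \<le> ((real N + c) / (real (Suc N) + c)) powr \<delta>" .
    moreover have "u (Suc N) \<le> (1 - \<delta> / (real N + c)) * u N"
      using step[OF that] pos by (simp add: field_simps \<delta>_def)
    ultimately have "u (Suc N) \<le> ((real N + c) / (real (Suc N) + c)) powr \<delta> * u N"
      using u0[of N] by (meson mult_right_mono order_trans)
    then have "u (Suc N) * (real (Suc N) + c) powr \<delta>
        \<le> ((real N + c) / (real (Suc N) + c)) powr \<delta> * u N * (real (Suc N) + c) powr \<delta>"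
      by (rule mult_right_mono) simp
    also have "\<dots> = u N * (real N + c) powr \<delta>"
      using pos by (simp add: powr_divide)
    finally show ?thesis .
  qed
  define C where "C = u M * (real M + c) powr \<delta>"
  have bound: "u N * (real N + c) powr \<delta> \<le> C" if "N \<ge> M" for N
    using that by (induction N rule: dec_induct) (use dec C_def in \<open>auto intro: order_trans\<close>)
  have "(\<lambda>N. C * (real N + c) powr (- \<delta>)) \<longlonglongrightarrow> C * 0"
    by (intro tendsto_mult tendsto_const tendsto_neg_powr \<open>0 < \<delta>\<close> [THEN iffD2[OF neg_less_0_iff_less]]
        filterlim_tendsto_add_at_top[OF tendsto_const filterlim_real_sequentially, of c, unfolded add.commute[of c]])
  then obtain L where L: "\<And>N. N \<ge> L \<Longrightarrow> \<bar>C * (real N + c) powr (- \<delta>)\<bar> < \<epsilon>"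
    using LIMSEQ_D[of _ "C * 0" \<epsilon>] \<epsilon> by auto
  have "norm (r N - 0) < \<epsilon>'" if "N \<ge> max M L" for N
  proof -
    have "0 < (real N + c) powr \<delta>" using y by simp
    then have "u N \<le> C * (real N + c) powr (- \<delta>)"
      using bound[of N] that by (simp add: powr_minus field_simps)
    also have "\<dots> < \<epsilon>" using L[of N] that by simp
    finally show ?thesis by (simp add: u_def \<epsilon>_def max_def split: if_splits)
  qed
  then show "\<exists>L. \<forall>N\<ge>L. norm (r N - 0) < \<epsilon>'" by blast
qed

section \<open>Convergence of Newton series of rational functions\<close>

text \<open>The \<open>j\<close>-th term of the Newton series of \<open>f\<close> at the nodes \<open>0, 1, 2, \<dots>\<close>, evaluated
  at \<open>- y\<close>: the sign \<open>(- 1) ^ j\<close> has moved from \<open>(- y) gchoose j\<close> to the difference.\<close>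

definition newton_term :: "real \<Rightarrow> (nat \<Rightarrow> real) \<Rightarrow> nat \<Rightarrow> real" where
  "newton_term y f j = pochhammer y j / fact j * (nabla 1 ^^ j) f 0"

lemma newton_term_0 [simp]: "newton_term y f 0 = f 0"
  by (simp add: newton_term_def)

lemma newton_term_sums_const: "newton_term y (\<lambda>n. r) sums r"
proof -
  have "newton_term y (\<lambda>n. r) j = 0" if "j \<notin> {0}" for j
    using that funpow_nabla_const by (cases j) (simp_all add: newton_term_def del: funpow.simps)
  then show ?thesis using sums_finite[of "{0}" "newton_term y (\<lambda>n. r)"] by simp
qed

text \<open>The Leibniz rule at 0, where the ratio of consecutive coefficients,
  \<open>(j + y) / (j + 1)\<close>, cancels the factor \<open>Suc j\<close>.\<close>

lemma newton_term_linear_mult: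
  "newton_term y (\<lambda>n. (real n + c) * f n) (Suc j) =
     (real (Suc j) + c) * newton_term y f (Suc j) - (real j + y) * newton_term y f j"
proof -
  have "pochhammer y (Suc j) / fact (Suc j) * real (Suc j) = (real j + y) * (pochhammer y j / fact j)"
    by (simp add: pochhammer_Suc field_simps del: of_nat_Suc)
  then have "pochhammer y (Suc j) / fact (Suc j) * (real (Suc j) * (nabla 1 ^^ j) f 0) =
      (real j + y) * (pochhammer y j / fact j * (nabla 1 ^^ j) f 0)"
    by (metis mult.assoc)
  moreover have "pochhammer y (Suc j) / fact (Suc j) *
      ((real 0 + real j + 1 + c) * (nabla 1 ^^ Suc j) f 0) =
      (real (Suc j) + c) * (pochhammer y (Suc j) / fact (Suc j) * (nabla 1 ^^ Suc j) f 0)"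
    by (simp only: of_nat_Suc of_nat_0 add_0 add.commute mult.left_commute)
  ultimately show ?thesis
    unfolding newton_term_def funpow_nabla_linear_mult right_diff_distrib by presburger
qed

text \<open>Summing \<open>newton_term_linear_mult\<close> telescopes. The number \<open>v\<close>
  is free: if the series of \<open>g\<close> has sum \<open>(c - y) * v\<close>, the last summand
  tends to 0 and the contracting recurrence applies to the remainders of \<open>f\<close>.\<close>

lemma newton_remainder_linear_mult:
  fixes f :: "nat \<Rightarrow> real" and c :: real
  defines "g \<equiv> \<lambda>n. (real n + c) * f n"
  shows "(real N + c) * (v - (\<Sum>j<Suc N. newton_term y f j)) =
    (real N + y) * (v - (\<Sum>j<N. newton_term y f j))
    + ((c - y) * v - (\<Sum>j<Suc N. newton_term y g j))"
proof (induction N)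
  case 0
  show ?case by (simp add: g_def algebra_simps)
next
  case (Suc N)
  have "newton_term y g (Suc N) =
      (real (Suc N) + c) * newton_term y f (Suc N) - (real N + y) * newton_term y f N"
    unfolding g_def by (rule newton_term_linear_mult)
  with Suc show ?case by (simp add: algebra_simps)
qed

lemma newton_term_sums_divide_linear:
  assumes y: "0 < y" "y < c" and g: "newton_term y g sums w"
  shows "newton_term y (\<lambda>n. g n / (real n + c)) sums (w / (c - y))"
proof -
  define f where "f n = g n / (real n + c)" for n
  define v where "v = w / (c - y)"
  have "real n + c \<noteq> 0" for n using y by (smt (verit) of_nat_0_le_iff)
  then have gf: "g = (\<lambda>n. (real n + c) * f n)" by (auto simp: f_def)
  have w: "(c - y) * v = w" using y by (simp add: v_def)
  have "(\<lambda>N. (c - y) * v - (\<Sum>j<Suc N. newton_term y g j)) \<longlonglongrightarrow> w - w"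
    using g unfolding w sums_def by (intro tendsto_diff tendsto_const) (rule LIMSEQ_Suc)
  then have "(\<lambda>N. (c - y) * v - (\<Sum>j<Suc N. newton_term y g j)) \<longlonglongrightarrow> 0" by simp
  then have "(\<lambda>N. v - (\<Sum>j<N. newton_term y f j)) \<longlonglongrightarrow> 0"
    by (rule tendsto_zero_of_contracting_recurrence[OF y])
       (use newton_remainder_linear_mult[of _ c v y f] gf in simp)
  from tendsto_diff[OF tendsto_const[of v] this] show ?thesis
    by (simp add: sums_def f_def[abs_def] v_def)
qed

text \<open>Since \<open>(n + a) / (n + c) = 1 + (a - c) / (n + c)\<close> and
  \<open>newton_term\<close> is linear in the sequence, division by \<open>n + c\<close> is the only
  operation that needs a convergence argument.\<close>

lemma newton_term_sums_mult_linear_fractional: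
  assumes y: "0 < y" "y < c" and g: "newton_term y g sums w"
  shows "newton_term y (\<lambda>n. g n * ((real n + a) / (real n + c))) sums (w * ((a - y) / (c - y)))"
proof -
  define h where "h n = g n / (real n + c)" for n
  have nz: "real n + c \<noteq> 0" for n using y by (smt (verit) of_nat_0_le_iff)
  have eq: "g n * ((real n + a) / (real n + c)) = g n + (a - c) * h n" for n
    using nz[of n] by (simp add: h_def field_simps)
  have "newton_term y (\<lambda>n. g n + (a - c) * h n) j = newton_term y g j + (a - c) * newton_term y h j" for j
    unfolding newton_term_def funpow_nabla_add funpow_nabla_cmult by (simp add: distrib_left)
  moreover have "w + (a - c) * (w / (c - y)) = w * ((a - y) / (c - y))"
    using y by (simp add: field_simps)
  moreover have "(\<lambda>j. newton_term y g j + (a - c) * newton_term y h j) sums (w + (a - c) * (w / (c - y)))"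
    using newton_term_sums_divide_linear[OF y g]
    by (intro sums_add sums_mult g) (simp add: h_def[abs_def])
  ultimately show ?thesis unfolding eq by presburger
qed

lemma newton_term_sums_prod:
  fixes a b :: "'i \<Rightarrow> real"
  assumes "finite I" "0 < y" "\<And>i. i \<in> I \<Longrightarrow> y < b i"
  shows "newton_term y (\<lambda>n. \<Prod>i\<in>I. (real n + a i) / (real n + b i)) sums
           (\<Prod>i\<in>I. (a i - y) / (b i - y))"
  using assms
proof (induction I rule: finite_induct)
  case empty
  show ?case using newton_term_sums_const[of y 1] by simp
next
  case (insert i I)
  have "newton_term y (\<lambda>n. (\<Prod>i\<in>I. (real n + a i) / (real n + b i)) * ((real n + a i) / (real n + b i)))
      sums ((\<Prod>i\<in>I. (a i - y) / (b i - y)) * ((a i - y) / (b i - y)))"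
    using insert by (intro newton_term_sums_mult_linear_fractional) auto
  then show ?case using insert.hyps by (simp add: mult.commute)
qed

section \<open>Behaviour of the quotient at infinity\<close>

lemma tendsto_prod_linear_fractional:
  fixes a b :: "'i \<Rightarrow> real"
  shows "(\<lambda>n. \<Prod>i\<in>I. (real n + a i) / (real n + b i)) \<longlonglongrightarrow> 1"
proof -
  have "(\<lambda>n. (real n + a i) / (real n + b i)) \<longlonglongrightarrow> 1" for i by real_asymp
  then have "(\<lambda>n. \<Prod>i\<in>I. (real n + a i) / (real n + b i)) \<longlonglongrightarrow> (\<Prod>i\<in>I. 1)"
    by (intro tendsto_prod)
  then show ?thesis by simp
qed

lemma tendsto_prod_linear_fractional_first_order:
  fixes a b :: "'i \<Rightarrow> real"
  assumes "finite I" "\<And>i. i \<in> I \<Longrightarrow> 0 < b i"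
  shows "(\<lambda>n. real n * ((\<Prod>i\<in>I. (real n + a i) / (real n + b i)) - 1)) \<longlonglongrightarrow> (\<Sum>i\<in>I. a i - b i)"
  using assms
proof (induction I rule: finite_induct)
  case empty
  show ?case by simp
next
  case (insert i I)
  define P where "P n = (\<Prod>i\<in>I. (real n + a i) / (real n + b i))" for n
  define x where "x n = (real n + a i) / (real n + b i)" for n
  have P: "(\<lambda>n. real n * (P n - 1)) \<longlonglongrightarrow> (\<Sum>i\<in>I. a i - b i)"
    using insert by (simp add: P_def)
  have x: "x \<longlonglongrightarrow> 1" unfolding x_def by real_asymp
  have "(\<lambda>n. real n / (real n + b i)) \<longlonglongrightarrow> 1" by real_asymp
  then have "(\<lambda>n. (a i - b i) * (real n / (real n + b i))) \<longlonglongrightarrow> (a i - b i) * 1"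
    by (intro tendsto_mult tendsto_const)
  moreover have "(a i - b i) * (real n / (real n + b i)) = real n * (x n - 1)" for n
    using insert.prems[of i] by (simp add: x_def field_simps)
  ultimately have "(\<lambda>n. real n * (P n - 1) * x n + real n * (x n - 1)) \<longlonglongrightarrow>
      (\<Sum>i\<in>I. a i - b i) * 1 + (a i - b i) * 1"
    by (intro tendsto_add tendsto_mult[OF P x]) (simp only:)
  \<comment> \<open>The splitting \<open>P * x - 1 = (P - 1) * x + (x - 1)\<close> makes the
    first-order coefficients add.\<close>
  moreover have "real n * (P n - 1) * x n + real n * (x n - 1) =
      real n * ((\<Prod>i\<in>insert i I. (real n + a i) / (real n + b i)) - 1)" for n
    using insert.hyps by (simp add: P_def x_def algebra_simps)
  ultimately show ?case using insert.hyps by (simp add: add.commute)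
qed

section \<open>Bounds from complete monotonicity and alternation\<close>

lemma completely_monotone_funpow_nabla:
  "completely_monotone \<phi> \<Longrightarrow> 0 \<le> (nabla 1 ^^ j) \<phi> m"
  unfolding completely_monotone_def
  \<comment> \<open>The order \<open>j = 0\<close> is separate, since the definition takes
    differences only along nonempty lists.\<close>
  by (cases "j = 0") (auto dest!: spec[of _ "replicate j 1"])

lemma completely_alternating_funpow_nabla:
  "completely_alternating \<psi> \<Longrightarrow> 0 < j \<Longrightarrow> (nabla 1 ^^ j) \<psi> m \<le> 0"
  unfolding completely_alternating_def by (auto dest!: spec[of _ "replicate j 1"])

lemma completely_monotone_ge_lim:
  assumes "completely_monotone \<phi>" "\<phi> \<longlonglongrightarrow> l"
  shows "l \<le> \<phi> n"
proof -
  have "\<phi> (Suc m) \<le> \<phi> m" for m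
    using completely_monotone_funpow_nabla[OF assms(1), of 1 m] by (simp add: nabla_def)
  then have "decseq \<phi>" by (rule decseq_SucI)
  then show ?thesis using assms(2) by (rule decseq_ge)
qed

lemma completely_alternating_le_lim:
  assumes "completely_alternating \<psi>" "\<psi> \<longlonglongrightarrow> l"
  shows "\<psi> n \<le> l"
proof -
  have "\<psi> m \<le> \<psi> (Suc m)" for m
    using completely_alternating_funpow_nabla[OF assms(1), of 1 m] by (simp add: nabla_def)
  then have "incseq \<psi>" by (rule incseq_SucI)
  then show ?thesis using assms(2) by (rule incseq_le)
qed

lemma completely_monotone_newton_ge:
  assumes "completely_monotone \<phi>" "0 \<le> y" "newton_term y \<phi> sums v"
  shows "\<phi> 0 \<le> v"
proof -
  have nonneg: "0 \<le> newton_term y \<phi> j" for j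
    using assms(2) completely_monotone_funpow_nabla[OF assms(1)]
    by (auto simp: newton_term_def pochhammer_prod intro!: mult_nonneg_nonneg divide_nonneg_nonneg prod_nonneg)
  have "sum (newton_term y \<phi>) {0} \<le> v"
    unfolding sums_unique[OF assms(3)]
    using nonneg sums_summable[OF assms(3)] by (intro sum_le_suminf) auto
  then show ?thesis by simp
qed

lemma completely_alternating_newton_le:
  assumes "completely_alternating \<psi>" "0 \<le> y" "newton_term y \<psi> sums v"
  shows "v \<le> \<psi> 0"
proof -
  \<comment> \<open>The term at \<open>j = 0\<close> is \<open>\<psi> 0\<close>, whose sign is not
    prescribed; only the later terms are nonpositive.\<close>
  have nonneg: "0 \<le> - newton_term y \<psi> j" if "j \<in> - {0}" for j
  proof -
    have "0 \<le> pochhammer y j / fact j"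
      using assms(2) by (simp add: pochhammer_prod prod_nonneg)
    then show ?thesis
      using that completely_alternating_funpow_nabla[OF assms(1), of j 0]
      unfolding newton_term_def by (simp only: neg_0_le_iff_le) (intro mult_nonneg_nonpos, auto)
  qed
  have "sum (\<lambda>j. - newton_term y \<psi> j) {0} \<le> - v"
    unfolding sums_unique[OF sums_minus[OF assms(3)]]
    using nonneg sums_summable[OF sums_minus[OF assms(3)]] by (intro sum_le_suminf) auto
  then show ?thesis by simp
qed

section \<open>Necessary conditions on the total and on the first difference\<close>

lemma completely_monotone_prod_sum_nonneg:
  fixes a b :: "'i \<Rightarrow> real"
  assumes "finite I" "\<And>i. i \<in> I \<Longrightarrow> 0 < b i"
    and "completely_monotone (\<lambda>n. \<Prod>i\<in>I. (real n + a i) / (real n + b i))"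
  shows "0 \<le> (\<Sum>i\<in>I. a i - b i)"
proof (rule LIMSEQ_le_const[OF tendsto_prod_linear_fractional_first_order])
  show "\<exists>N. \<forall>n\<ge>N. 0 \<le> real n * ((\<Prod>i\<in>I. (real n + a i) / (real n + b i)) - 1)"
    using completely_monotone_ge_lim[OF assms(3) tendsto_prod_linear_fractional]
    by auto
qed (use assms in auto)

lemma completely_alternating_prod_sum_nonpos:
  fixes a b :: "'i \<Rightarrow> real"
  assumes "finite I" "\<And>i. i \<in> I \<Longrightarrow> 0 < b i"
    and "completely_alternating (\<lambda>n. \<Prod>i\<in>I. (real n + a i) / (real n + b i))"
  shows "(\<Sum>i\<in>I. a i - b i) \<le> 0"
proof (rule LIMSEQ_le_const2[OF tendsto_prod_linear_fractional_first_order])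
  show "\<exists>N. \<forall>n\<ge>N. real n * ((\<Prod>i\<in>I. (real n + a i) / (real n + b i)) - 1) \<le> 0"
    using completely_alternating_le_lim[OF assms(3) tendsto_prod_linear_fractional]
    by (auto intro!: mult_nonneg_nonpos)
qed (use assms in auto)

text \<open>Otherwise \<open>0 < a m < b m \<le> b i\<close>, so the Newton series converges at
  \<open>y = a m\<close>. Its value there is 0 because of the factor \<open>i = m\<close>, yet it
  bounds the positive value at \<open>n = 0\<close> from above.\<close>

lemma completely_monotone_prod_min_le:
  fixes a b :: "'i \<Rightarrow> real"
  assumes "finite I" "\<And>i. i \<in> I \<Longrightarrow> 0 < a i" "\<And>i. i \<in> I \<Longrightarrow> 0 < b i"
    and cm: "completely_monotone (\<lambda>n. \<Prod>i\<in>I. (real n + a i) / (real n + b i))"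
    and m: "m \<in> I" "\<And>i. i \<in> I \<Longrightarrow> b m \<le> b i"
  shows "b m \<le> a m"
proof (rule ccontr)
  assume "\<not> b m \<le> a m"
  then have "(\<Prod>i\<in>I. (real 0 + a i) / (real 0 + b i)) \<le> (\<Prod>i\<in>I. (a i - a m) / (b i - a m))"
    using assms m by (intro completely_monotone_newton_ge[OF cm, of "a m"] newton_term_sums_prod)
      (force intro: less_imp_le)+
  also have "\<dots> = 0" using assms(1) m by (auto simp: prod_zero_iff)
  finally have "(\<Prod>i\<in>I. a i / b i) \<le> 0" by simp
  moreover have "0 < (\<Prod>i\<in>I. a i / b i)" using assms by (intro prod_pos) simp
  ultimately show False by simp
qed

text \<open>If \<open>b m < a m\<close>, the Newton value blows up as \<open>y\<close> increases to
  \<open>b m\<close>, although the value at \<open>n = 0\<close> bounds it. With denominators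
  cleared, the limit reads as a product of positive factors being at most 0; minimality of
  \<open>a m\<close> gives the positivity.\<close>

lemma completely_alternating_prod_min_ge:
  fixes a b :: "'i \<Rightarrow> real"
  assumes "finite I" "\<And>i. i \<in> I \<Longrightarrow> 0 < b i"
    and ca: "completely_alternating (\<lambda>n. \<Prod>i\<in>I. (real n + a i) / (real n + b i))"
    and m: "m \<in> I" "\<And>i. i \<in> I \<Longrightarrow> b m \<le> b i" "\<And>i. i \<in> I \<Longrightarrow> a m \<le> a i"
  shows "a m \<le> b m"
proof (rule ccontr)
  assume less: "\<not> a m \<le> b m"
  define C where "C = (\<Prod>i\<in>I. a i / b i)"
  have le: "(\<Prod>i\<in>I. a i - y) \<le> C * (\<Prod>i\<in>I. b i - y)" if "0 < y" "y < b m" for y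
  proof -
    have y: "y < b i" if "i \<in> I" for i using m(2)[OF that] \<open>y < b m\<close> by simp
    have "(\<Prod>i\<in>I. (a i - y) / (b i - y)) \<le> (\<Prod>i\<in>I. (real 0 + a i) / (real 0 + b i))"
      using assms(1) \<open>0 < y\<close> y
      by (intro completely_alternating_newton_le[OF ca, of y] newton_term_sums_prod) auto
    moreover have "0 < (\<Prod>i\<in>I. b i - y)" using y by (intro prod_pos) simp
    ultimately show ?thesis by (simp add: C_def prod_dividef pos_divide_le_eq)
  qed
  have "(\<Prod>i\<in>I. a i - b m) \<le> C * (\<Prod>i\<in>I. b i - b m)"
  proof (rule tendsto_le[OF trivial_limit_at_left_real])
    show "((\<lambda>y. C * (\<Prod>i\<in>I. b i - y)) \<longlongrightarrow> C * (\<Prod>i\<in>I. b i - b m)) (at_left (b m))"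
      by (intro tendsto_intros)
    show "((\<lambda>y. \<Prod>i\<in>I. a i - y) \<longlongrightarrow> (\<Prod>i\<in>I. a i - b m)) (at_left (b m))"
      by (intro tendsto_intros)
    show "\<forall>\<^sub>F y in at_left (b m). (\<Prod>i\<in>I. a i - y) \<le> C * (\<Prod>i\<in>I. b i - y)"
      using le assms(2) m(1) by (auto simp: eventually_at_left_field)
  qed
  also have "\<dots> = 0" using assms(1) m(1) by (auto simp: prod_zero_iff)
  finally have "(\<Prod>i\<in>I. a i - b m) \<le> 0" .
  moreover have "0 < (\<Prod>i\<in>I. a i - b m)" using m(3) less by (intro prod_pos) force
  ultimately show False by simp
qed

theorem theorem1p7:
  fixes k :: nat and a b :: "nat \<Rightarrow> real" and p q :: "real \<Rightarrow> real"
  assumes "1 \<le> k"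
    and "mono_on {1..k} a" and "\<forall>i\<in>{1..k}. 0 < a i"
    and "mono_on {1..k} b" and "\<forall>i\<in>{1..k}. 0 < b i"
    and "p = (\<lambda>x. \<Prod>i=1..k. (x + a i))"
    and "q = (\<lambda>x. \<Prod>i=1..k. (x + b i))"
  shows "(completely_monotone (\<lambda>n. p (real n) / q (real n)) \<longrightarrow>
            (\<exists>\<sigma>. \<sigma> permutes {1..k} \<and> \<sigma> 1 = 1 \<and>
               (\<forall>l\<in>{1..k}. (\<Sum>i=1..l. b (\<sigma> i)) \<le> (\<Sum>i=1..l. a (\<sigma> i))))) \<and>
         (completely_alternating (\<lambda>n. p (real n) / q (real n)) \<longrightarrow>
            (\<exists>\<sigma>. \<sigma> permutes {1..k} \<and> \<sigma> 1 = 1 \<and>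
               (\<forall>l\<in>{1..k}. (\<Sum>i=1..l. a (\<sigma> i)) \<le> (\<Sum>i=1..l. b (\<sigma> i)))))"
proof -
  have quot: "(\<lambda>n. p (real n) / q (real n)) = (\<lambda>n. \<Prod>i\<in>{1..k}. (real n + a i) / (real n + b i))"
    by (simp add: assms(6,7) prod_dividef)
  have one: "1 \<in> {1..k}" using assms(1) by simp
  have a: "\<And>i. i \<in> {1..k} \<Longrightarrow> 0 < a i" and b: "\<And>i. i \<in> {1..k} \<Longrightarrow> 0 < b i"
    using assms(3,5) by auto
  have a1: "\<And>i. i \<in> {1..k} \<Longrightarrow> a 1 \<le> a i" and b1: "\<And>i. i \<in> {1..k} \<Longrightarrow> b 1 \<le> b i"
    using mono_onD[OF assms(2) one] mono_onD[OF assms(4) one] by auto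
  note fin = finite_atLeastAtMost[of "1::nat" k]
  show ?thesis
    unfolding quot
  proof (intro conjI impI)
    assume cm: "completely_monotone (\<lambda>n. \<Prod>i\<in>{1..k}. (real n + a i) / (real n + b i))"
    show "\<exists>\<sigma>. \<sigma> permutes {1..k} \<and> \<sigma> 1 = 1 \<and>
        (\<forall>l\<in>{1..k}. (\<Sum>i=1..l. b (\<sigma> i)) \<le> (\<Sum>i=1..l. a (\<sigma> i)))"
      using exists_permutation_nonneg_partial_sums[of k "\<lambda>i. a i - b i"] assms(1)
        completely_monotone_prod_min_le[OF fin a b cm one b1]
        completely_monotone_prod_sum_nonneg[OF fin b cm]
      by (simp add: sum_subtractf)
  next
    assume ca: "completely_alternating (\<lambda>n. \<Prod>i\<in>{1..k}. (real n + a i) / (real n + b i))"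
    show "\<exists>\<sigma>. \<sigma> permutes {1..k} \<and> \<sigma> 1 = 1 \<and>
        (\<forall>l\<in>{1..k}. (\<Sum>i=1..l. a (\<sigma> i)) \<le> (\<Sum>i=1..l. b (\<sigma> i)))"
      using exists_permutation_nonneg_partial_sums[of k "\<lambda>i. b i - a i"] assms(1)
        completely_alternating_prod_min_ge[OF fin b ca one b1 a1]
        completely_alternating_prod_sum_nonpos[OF fin b ca]
      by (simp add: sum_subtractf)
  qed
qed

end
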